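(* Let $A$ be a commutative ring with identity. Every irreducible and closed subset of $\operatorname{Sq} A$ has a generic point.
   Context: A proper ideal $\mathfrak{q}$ of $A$ is called quasi-prime if whenever $fg\in\mathfrak{q}$ with $f,g\in A$, then $f\in\sqrt{\mathfrak{q}}$ or $g\in\sqrt{\mathfrak{q}}$. The quasi-prime spectrum $\operatorname{Sq} A$ is the set of all quasi-prime ideals of $A$, with the topology having as basis of opens the sets $U_f=\{\mathfrak{q}\in\operatorname{Sq} A: \mathfrak{q}\cap S_f=\emptyset\}$ for $f\in A$, where $S_f=\{f^i : i\ge 0\}=\{1,f,f^2,\dots\}$. A topological space is irreducible if it is non-empty and is not the union of two proper closed subsets. A generic point of a closed subset $Z$ is a point $z\in Z$ with $\overline{\{z\}}=Z$ (not required to be unique). *)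

theory Defs
  imports "HOL-Algebra.Ideal" "HOL-Analysis.Abstract_Topology"
begin

definition radical :: "('a, 'b) ring_scheme \<Rightarrow> 'a set \<Rightarrow> 'a set" where
  "radical R I = {x \<in> carrier R. \<exists>n::nat. n > 0 \<and> x [^]\<^bsub>R\<^esub> n \<in> I}"

locale quasiprimeideal = ideal + cring +
  assumes I_notcarr: "carrier R \<noteq> I"
    and I_quasiprime:
      "\<lbrakk>f \<in> carrier R; g \<in> carrier R; f \<otimes> g \<in> I\<rbrakk> \<Longrightarrow> f \<in> radical R I \<or> g \<in> radical R I"

definition Sq :: "('a, 'b) ring_scheme \<Rightarrow> 'a set set" where
  "Sq R = {Q. quasiprimeideal Q R}"

definition powers_of :: "('a, 'b) ring_scheme \<Rightarrow> 'a \<Rightarrow> 'a set" where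
  "powers_of R f = {f [^]\<^bsub>R\<^esub> i | i::nat. True}"

definition Sq_basic_open :: "('a, 'b) ring_scheme \<Rightarrow> 'a \<Rightarrow> 'a set set" where
  "Sq_basic_open R f = {Q \<in> Sq R. Q \<inter> powers_of R f = {}}"

(* The opens are the arbitrary unions of basic opens; openin_Sq_topology and topspace_Sq_topology
   below confirm that over a commutative ring these form a topology on Sq R. *)
definition Sq_topology :: "('a, 'b) ring_scheme \<Rightarrow> 'a set topology" where
  "Sq_topology R =
     topology (arbitrary union_of (\<lambda>U. \<exists>f \<in> carrier R. U = Sq_basic_open R f))"

(* Irreducibility of a subset Z of X is irreducibility of the space subtopology X Z. *)
definition irreducible_space :: "'a topology \<Rightarrow> bool" where
  "irreducible_space X \<longleftrightarrow> topspace X \<noteq> {} \<and>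
     \<not> (\<exists>C D. closedin X C \<and> closedin X D \<and> C \<noteq> topspace X \<and> D \<noteq> topspace X \<and>
             C \<union> D = topspace X)"

definition generic_point :: "'a topology \<Rightarrow> 'a set \<Rightarrow> 'a \<Rightarrow> bool" where
  "generic_point X Z z \<longleftrightarrow> z \<in> Z \<and> X closure_of {z} = Z"

context cring
begin

lemma mem_Sq_basic_open:
  assumes "f \<in> carrier R"
  shows "Q \<in> Sq_basic_open R f \<longleftrightarrow> quasiprimeideal Q R \<and> f \<notin> radical R Q"
proof -
  have "(Q \<inter> powers_of R f = {}) \<longleftrightarrow> f \<notin> radical R Q" if Q: "quasiprimeideal Q R"
  proof -
    interpret quasiprimeideal Q R by (fact Q)
    have "\<one> \<notin> Q"
      using I_notcarr one_imp_carrier by blast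
    then have "f [^] i \<in> Q \<longrightarrow> i > 0" for i :: nat
      by (cases i) auto
    then show ?thesis
      using assms unfolding powers_of_def radical_def by blast
  qed
  then show ?thesis
    unfolding Sq_basic_open_def Sq_def by blast
qed

lemma Sq_basic_open_mult:
  assumes f: "f \<in> carrier R" and g: "g \<in> carrier R"
  shows "Sq_basic_open R (f \<otimes> g) = Sq_basic_open R f \<inter> Sq_basic_open R g"
proof -
  have "f \<otimes> g \<in> radical R Q \<longleftrightarrow> f \<in> radical R Q \<or> g \<in> radical R Q"
    if Q: "quasiprimeideal Q R" for Q
  proof -
    interpret quasiprimeideal Q R by (fact Q)
    have pow_radical: "x \<in> radical R Q"
      if x: "x \<in> carrier R" and n: "x [^] n \<in> radical R Q" "n > 0" for x and n :: nat
    proof -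
      obtain m :: nat where "m > 0" "(x [^] n) [^] m \<in> Q"
        using n(1) unfolding radical_def by blast
      then have "n * m > 0" "x [^] (n * m) \<in> Q"
        using x n(2) by (simp_all add: nat_pow_pow)
      then show ?thesis
        using x unfolding radical_def by blast
    qed
    show ?thesis
    proof
      assume "f \<otimes> g \<in> radical R Q"
      then obtain n :: nat where n: "n > 0" "(f \<otimes> g) [^] n \<in> Q"
        unfolding radical_def by blast
      then have "f [^] n \<otimes> g [^] n \<in> Q"
        using f g by (simp add: nat_pow_distrib)
      then have "f [^] n \<in> radical R Q \<or> g [^] n \<in> radical R Q"
        using I_quasiprime f g by simp
      then show "f \<in> radical R Q \<or> g \<in> radical R Q"
        using pow_radical[of f n] pow_radical[of g n] f g n(1) by blast
    next
      assume "f \<in> radical R Q \<or> g \<in> radical R Q"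
      then obtain n :: nat where n: "n > 0" "f [^] n \<in> Q \<or> g [^] n \<in> Q"
        unfolding radical_def by blast
      then have "(f \<otimes> g) [^] n \<in> Q"
        using f g I_l_closed I_r_closed by (auto simp: nat_pow_distrib)
      then show "f \<otimes> g \<in> radical R Q"
        using f g n(1) unfolding radical_def by blast
    qed
  qed
  then show ?thesis
    using mem_Sq_basic_open f g by auto
qed

lemma openin_Sq_topology:
  "openin (Sq_topology R) =
     arbitrary union_of (\<lambda>U. \<exists>f \<in> carrier R. U = Sq_basic_open R f)"
  unfolding Sq_topology_def
proof (rule topology_inverse', rule istopology_base)
  fix U V
  assume "\<exists>f \<in> carrier R. U = Sq_basic_open R f" "\<exists>g \<in> carrier R. V = Sq_basic_open R g"
  then obtain f g where "f \<in> carrier R" "g \<in> carrier R"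
      "U = Sq_basic_open R f" "V = Sq_basic_open R g"
    by blast
  then have "f \<otimes> g \<in> carrier R" "U \<inter> V = Sq_basic_open R (f \<otimes> g)"
    by (simp_all add: Sq_basic_open_mult)
  then show "\<exists>f \<in> carrier R. U \<inter> V = Sq_basic_open R f"
    by blast
qed

lemma topspace_Sq_topology: "topspace (Sq_topology R) = Sq R"
proof -
  have "\<one> \<notin> radical R Q" if "quasiprimeideal Q R" for Q
  proof -
    interpret quasiprimeideal Q R by (fact that)
    show ?thesis
      using I_notcarr one_imp_carrier by (auto simp: radical_def)
  qed
  then have "Sq_basic_open R \<one> = Sq R"
    using mem_Sq_basic_open[OF one_closed] by (auto simp: Sq_def)
  then have "openin (Sq_topology R) (Sq R)"
    unfolding openin_Sq_topology by (intro arbitrary_union_of_inc bexI[of _ \<one>]) auto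
  moreover have "U \<subseteq> Sq R" if "openin (Sq_topology R) U" for U
    using that unfolding openin_Sq_topology union_of_def Sq_basic_open_def by fast
  ultimately show ?thesis
    unfolding topspace_def by blast
qed

end

end

theory Submission
  imports Defs
begin

text \<open>
  The elements \<open>f\<close> whose basic open \<open>Sq_basic_open R f\<close> misses \<open>Z\<close> are exactly those lying in
  the radical of every member of \<open>Z\<close>. They form an ideal \<open>P\<close>, because radicals of ideals are
  ideals. Irreducibility of \<open>Z\<close> makes \<open>P\<close> prime: if \<open>f \<otimes> g \<in> P\<close>, then the basic opens of \<open>f\<close>
  and \<open>g\<close> have disjoint traces on \<open>Z\<close>, and two disjoint open subsets of an irreducible space
  cannot both be non-empty (\<open>primeideal_vanishing_elements\<close>).

  A prime ideal is its own radical, so \<open>P\<close> is quasi-prime and \<open>P\<close> lies in the basic open of \<open>f\<close>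
  iff \<open>f \<notin> P\<close>, that is, iff the basic open of \<open>f\<close> meets \<open>Z\<close>. This equivalence is the generic point
  property (\<open>generic_pointI_base\<close>). The generic point need not be unique, since the topology
  cannot distinguish quasi-prime ideals with the same radical; \<open>P\<close> is the one that is prime.
\<close>

section \<open>Generic points and irreducible closed sets\<close>

text \<open>
  A point lies in a closed set as soon as each of its basic neighbourhoods meets that set, and its
  closure contains \<open>Z\<close> as soon as it lies in every basic open that meets \<open>Z\<close>.
\<close>

lemma generic_pointI_base:
  assumes base: "openin X = arbitrary union_of B"
    and Z: "closedin X Z" and z: "z \<in> topspace X"
    and meets: "\<And>U. B U \<Longrightarrow> z \<in> U \<longleftrightarrow> U \<inter> Z \<noteq> {}"
  shows "generic_point X Z z"
proof -
  have basic: "\<exists>U. B U \<and> x \<in> U \<and> U \<subseteq> V" if "openin X V" "x \<in> V" for V x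
    using that unfolding base arbitrary_union_of_alt by blast
  have "z \<in> Z"
  proof (rule ccontr)
    assume "z \<notin> Z"
    then obtain U where "B U" "z \<in> U" "U \<subseteq> topspace X - Z"
      using basic[of "topspace X - Z" z] Z z by (auto simp: closedin_def)
    then show False
      using meets by blast
  qed
  moreover have "X closure_of {z} = Z"
  proof
    show "X closure_of {z} \<subseteq> Z"
      using \<open>z \<in> Z\<close> Z by (simp add: closure_of_minimal)
    show "Z \<subseteq> X closure_of {z}"
    proof
      fix x assume x: "x \<in> Z"
      have "z \<in> V" if V: "x \<in> V" "openin X V" for V
        using basic[OF V(2,1)] meets x by blast
      moreover have "x \<in> topspace X"
        using x Z closedin_subset by blast
      ultimately show "x \<in> X closure_of {z}"
        by (auto simp: in_closure_of)
    qed
  qed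
  ultimately show ?thesis
    by (simp add: generic_point_def)
qed

lemma irreducible_space_opens_meet:
  assumes X: "irreducible_space (subtopology X Z)"
    and U: "openin X U" and V: "openin X V"
    and UZ: "U \<inter> Z \<noteq> {}" and VZ: "V \<inter> Z \<noteq> {}"
  shows "U \<inter> V \<inter> Z \<noteq> {}"
proof
  assume disj: "U \<inter> V \<inter> Z = {}"
  let ?Y = "subtopology X Z"
  let ?C = "topspace ?Y - U \<inter> Z" and ?D = "topspace ?Y - V \<inter> Z"
  have "openin ?Y (U \<inter> Z)" "openin ?Y (V \<inter> Z)"
    using U V by (auto intro: openin_subtopology_Int)
  then have "closedin ?Y ?C" "closedin ?Y ?D"
      and "U \<inter> Z \<subseteq> topspace ?Y" "V \<inter> Z \<subseteq> topspace ?Y"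
    using openin_subset by blast+
  moreover from this have "?C \<noteq> topspace ?Y" "?D \<noteq> topspace ?Y" "?C \<union> ?D = topspace ?Y"
    using disj UZ VZ by blast+
  ultimately show False
    using X unfolding irreducible_space_def by blast
qed

section \<open>Radicals\<close>

text \<open>
  Closure under sums avoids the binomial theorem: expanding one factor \<open>a \<oplus> b\<close> at a time, every
  product of \<open>n + m\<close> factors taken from \<open>a\<close>, \<open>b\<close> and \<open>a \<oplus> b\<close> is seen to lie in \<open>I\<close>, since
  once only \<open>a\<close> and \<open>b\<close> remain, there are at least \<open>n\<close> factors \<open>a\<close> or at least \<open>m\<close> factors \<open>b\<close>.
\<close>

lemma (in cring) radical_add:
  assumes "ideal I R" and a: "a \<in> radical R I" and b: "b \<in> radical R I"
  shows "a \<oplus> b \<in> radical R I"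
proof -
  interpret ideal I R by fact
  obtain n m :: nat where ab: "a \<in> carrier R" "b \<in> carrier R"
      and n: "n > 0" "a [^] n \<in> I" and m: "b [^] m \<in> I"
    using a b unfolding radical_def by blast
  have "a [^] i \<otimes> b [^] j \<otimes> (a \<oplus> b) [^] k \<in> I" if "i + j + k = n + m" for i j k
    using that
  proof (induction k arbitrary: i j)
    case 0
    then consider "n \<le> i" | "m \<le> j"
      by linarith
    then show ?case
    proof cases
      case 1
      then have "a [^] i = a [^] n \<otimes> a [^] (i - n)"
        using ab by (simp add: nat_pow_mult)
      then show ?thesis
        using n ab by (simp add: I_r_closed)
    next
      case 2
      then have "b [^] j = b [^] m \<otimes> b [^] (j - m)"
        using ab by (simp add: nat_pow_mult)
      then show ?thesis
        using m ab by (simp add: I_l_closed I_r_closed)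
    qed
  next
    case (Suc k)
    let ?c = "a [^] i \<otimes> b [^] j \<otimes> (a \<oplus> b) [^] k"
    have "a [^] i \<otimes> b [^] j \<otimes> (a \<oplus> b) [^] Suc k = ?c \<otimes> a \<oplus> ?c \<otimes> b"
      using ab by (simp add: m_assoc flip: r_distr)
    also have "\<dots> = a [^] Suc i \<otimes> b [^] j \<otimes> (a \<oplus> b) [^] k \<oplus> a [^] i \<otimes> b [^] Suc j \<otimes> (a \<oplus> b) [^] k"
      using ab by (simp add: m_ac)
    finally show ?case
      using Suc.IH[of "Suc i" j] Suc.IH[of i "Suc j"] Suc.prems by simp
  qed
  from this[of 0 0 "n + m"] have "(a \<oplus> b) [^] (n + m) \<in> I"
    using ab by simp
  then show ?thesis
    using ab n(1) unfolding radical_def by (auto intro!: exI[of _ "n + m"])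
qed

lemma (in cring) ideal_radical:
  assumes "ideal I R"
  shows "ideal (radical R I) R"
proof -
  interpret ideal I R by fact
  have mult: "x \<otimes> a \<in> radical R I" if a: "a \<in> radical R I" and x: "x \<in> carrier R" for a x
  proof -
    obtain n :: nat where "n > 0" "a \<in> carrier R" "a [^] n \<in> I"
      using a unfolding radical_def by blast
    then show ?thesis
      using x I_l_closed unfolding radical_def by (auto simp: nat_pow_distrib intro!: exI[of _ n])
  qed
  have carr: "radical R I \<subseteq> carrier R"
    by (auto simp: radical_def)
  have "\<zero> \<in> radical R I"
    using additive_subgroup.zero_closed[OF is_additive_subgroup]
    unfolding radical_def by (auto intro!: exI[of _ "1::nat"])
  moreover have "\<ominus> a \<in> radical R I" if "a \<in> radical R I" for a
    using mult[of a "\<ominus> \<one>"] that carr by (auto simp: l_minus)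
  ultimately have "subgroup (radical R I) (add_monoid R)"
    using carr radical_add[OF assms] by (auto intro!: subgroup.intro simp: a_inv_def[symmetric])
  moreover have "a \<otimes> x \<in> radical R I" if "a \<in> radical R I" "x \<in> carrier R" for a x
    using mult[OF that] that carr by (auto simp: m_comm)
  ultimately show ?thesis
    using mult by (blast intro: idealI ring_axioms)
qed

lemma (in primeideal) radical_eq: "radical R I = I"
proof
  have "x \<in> I" if "x \<in> carrier R" "x [^] n \<in> I" for x and n :: nat
    using that(2)
  proof (induction n)
    case 0
    then show ?case
      using I_notcarr one_imp_carrier by auto
  next
    case (Suc n)
    then show ?case
      using I_prime[of "x [^] n" x] that(1) by auto
  qed
  then show "radical R I \<subseteq> I"
    unfolding radical_def by blast
  show "I \<subseteq> radical R I"
    unfolding radical_def by (auto simp: a_Hcarr intro!: exI[of _ "1::nat"])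
qed

lemma (in primeideal) quasiprimeideal: "quasiprimeideal I R"
  by unfold_locales (use I_notcarr I_prime in \<open>auto simp: radical_eq\<close>)

section \<open>The prime ideal of an irreducible set\<close>

text \<open>
  The analogue of the ideal of functions vanishing on \<open>Z\<close>. It is phrased through basic opens so
  that irreducibility of \<open>Z\<close> applies directly; the description by radicals shows that it is an
  ideal.
\<close>

definition vanishing_elements :: "('a, 'b) ring_scheme \<Rightarrow> 'a set set \<Rightarrow> 'a set" where
  "vanishing_elements R Z = {f \<in> carrier R. Sq_basic_open R f \<inter> Z = {}}"

context cring
begin

lemma openin_Sq_basic_open:
  assumes "f \<in> carrier R"
  shows "openin (Sq_topology R) (Sq_basic_open R f)"
  unfolding openin_Sq_topology by (rule arbitrary_union_of_inc) (use assms in blast)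

lemma vanishing_elements_eq_Inter_radical:
  assumes "Z \<subseteq> Sq R" and "Z \<noteq> {}"
  shows "vanishing_elements R Z = (\<Inter>Q\<in>Z. radical R Q)"
proof (rule Set.set_eqI)
  fix f
  show "f \<in> vanishing_elements R Z \<longleftrightarrow> f \<in> (\<Inter>Q\<in>Z. radical R Q)"
  proof (cases "f \<in> carrier R")
    case True
    have "quasiprimeideal Q R" if "Q \<in> Z" for Q
      using that assms(1) by (auto simp: Sq_def)
    then show ?thesis
      using True mem_Sq_basic_open[OF True] by (simp add: vanishing_elements_def disjoint_iff) blast
  next
    case False
    then show ?thesis
      using assms(2) by (auto simp: vanishing_elements_def radical_def)
  qed
qed

lemma primeideal_vanishing_elements:
  assumes Z: "Z \<subseteq> Sq R" and irr: "irreducible_space (subtopology (Sq_topology R) Z)"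
  shows "primeideal (vanishing_elements R Z) R"
proof (rule primeidealI)
  have ne: "Z \<noteq> {}"
    using irr by (auto simp: irreducible_space_def)
  have eq: "vanishing_elements R Z = \<Inter> (radical R ` Z)"
    using vanishing_elements_eq_Inter_radical[OF Z ne] .
  have quasi: "quasiprimeideal Q R" if "Q \<in> Z" for Q
    using that Z by (auto simp: Sq_def)
  then have "ideal (radical R Q) R" if "Q \<in> Z" for Q
    using that by (intro ideal_radical quasiprimeideal.axioms(1))
  then show "ideal (vanishing_elements R Z) R"
    unfolding eq using ne by (intro i_Intersect) auto
  show "cring R" ..
  obtain Q where "Q \<in> Z"
    using ne by blast
  interpret Q: quasiprimeideal Q R
    using quasi[OF \<open>Q \<in> Z\<close>] .
  have "\<one> \<notin> radical R Q"
    using Q.I_notcarr Q.one_imp_carrier by (auto simp: radical_def)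
  then show "carrier R \<noteq> vanishing_elements R Z"
    unfolding eq using \<open>Q \<in> Z\<close> by blast
  fix f g
  assume f: "f \<in> carrier R" and g: "g \<in> carrier R" and "f \<otimes> g \<in> vanishing_elements R Z"
  then have "Sq_basic_open R f \<inter> Sq_basic_open R g \<inter> Z = {}"
    by (simp add: vanishing_elements_def Sq_basic_open_mult)
  then have "Sq_basic_open R f \<inter> Z = {} \<or> Sq_basic_open R g \<inter> Z = {}"
    using irreducible_space_opens_meet[OF irr] openin_Sq_basic_open f g by blast
  then show "f \<in> vanishing_elements R Z \<or> g \<in> vanishing_elements R Z"
    using f g by (auto simp: vanishing_elements_def)
qed

end

theorem proposition6p1:
  fixes A :: "('a, 'b) ring_scheme" and Z :: "'a set set"
  assumes "cring A"
    and "closedin (Sq_topology A) Z"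
    and "irreducible_space (subtopology (Sq_topology A) Z)"
  shows "\<exists>z. generic_point (Sq_topology A) Z z"
proof -
  interpret cring A by fact
  let ?P = "vanishing_elements A Z"
  have "Z \<subseteq> Sq A"
    using closedin_subset[OF assms(2)] by (simp add: topspace_Sq_topology)
  then have "primeideal ?P A"
    using assms(3) by (rule primeideal_vanishing_elements)
  then have rad: "radical A ?P = ?P" and quasi: "quasiprimeideal ?P A"
    by (rule primeideal.radical_eq, rule primeideal.quasiprimeideal)
  have "?P \<in> Sq_basic_open A f \<longleftrightarrow> Sq_basic_open A f \<inter> Z \<noteq> {}" if f: "f \<in> carrier A" for f
  proof -
    have "?P \<in> Sq_basic_open A f \<longleftrightarrow> f \<notin> ?P"
      unfolding mem_Sq_basic_open[OF f] rad using quasi by blast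
    also have "\<dots> \<longleftrightarrow> Sq_basic_open A f \<inter> Z \<noteq> {}"
      using f by (simp add: vanishing_elements_def)
    finally show ?thesis .
  qed
  moreover have "?P \<in> topspace (Sq_topology A)"
    using quasi by (simp add: topspace_Sq_topology Sq_def)
  ultimately have "generic_point (Sq_topology A) Z ?P"
    using generic_pointI_base[OF openin_Sq_topology assms(2)] by blast
  then show ?thesis ..
qed

end
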